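(* On a two-level substrate whose stations reside at a fast level of capacity $S$ words of $w$ bits (the slow level, where the input matrices reside, may be the environment), with fare $c_0$ per bit crossing the boundary between the two levels, any computation of $n\times n$ matrix multiplication by its $n^3$ elementary products performs $\Omega(n^3/\sqrt S)$ boundary crossings of $w$-bit words, hence pays fare $E\ge c_0\,w\,\Omega(n^3/\sqrt S)$. A streaming blocked schedule achieves it: there is a schedule performing $O(n^3/\sqrt S)$ word crossings.
   Context: The substrate has a fast level $0$ holding at most $S$ words and a slow level of unbounded capacity. Operations fire at stations located at the fast level and read only words resident there, writing their results there. A move carries data across the boundary between levels at energy $c_0$ per bit; a $w$-bit word crossing is $w$ bit crossings. The energy is at least $c_0$ times the number of bits crossing. "By its $n^3$ elementary products" means that for $C=AB$ every product $A_{ik}B_{kj}$ is computed by an operation at a fast-level station, with $A_{ik}$ and $B_{kj}$ resident there, and contributes to (a partial sum of) $C_{ij}$, as in the classical Hong–Kung / Irony–Toledo–Tiskin setting; partial sums evicted and re-imported count as crossings.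
   Formalization: The schedule with O(n^3/√S) word crossings is claimed only for 2 ≤ S ≤ K n^2 (any K, constant depending on K): for S much larger than n^2 the 2n^2 compulsory input loads exceed n^3/√S, and for S = 1 two operands cannot both be resident. *)

theory Defs
  imports Complex_Main
begin

text \<open>
  A schedule manipulates symbolic words: a word is identified by what it holds, so that a level of
  the memory is a set of words. \<open>PSum i j K\<close> holds the partial sum of \<open>C i j\<close> over the index
  set \<open>K\<close>, and \<open>Aux x\<close> is any other intermediate result. A second copy of a word takes no room.
\<close>

datatype word =
    InA nat nat
  | InB nat nat
  | PSum nat nat "nat set"
  | Aux nat

datatype operation =
    Zero nat nat                    \<comment> \<open>\<open>Zero i j\<close> starts an accumulator for \<open>C i j\<close>\<close>
  | Mul nat nat nat                 \<comment> \<open>\<open>Mul i k j\<close>: the product \<open>A i k * B k j\<close> as a one-term sum\<close>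
  | Fma nat nat nat "nat set"       \<comment> \<open>\<open>Fma i k j K\<close>: adds \<open>A i k * B k j\<close> to \<open>PSum i j K\<close>\<close>
  | Add nat nat "nat set" "nat set" \<comment> \<open>\<open>Add i j K L\<close>: \<open>PSum i j K\<close> plus \<open>PSum i j L\<close>\<close>
  | Other "word set" nat            \<comment> \<open>\<open>Other R x\<close>: an arbitrary function of the words \<open>R\<close>\<close>

fun operands :: "operation \<Rightarrow> word set" where
  "operands (Zero i j) = {}"
| "operands (Mul i k j) = {InA i k, InB k j}"
| "operands (Fma i k j K) = {InA i k, InB k j, PSum i j K}"
| "operands (Add i j K L) = {PSum i j K, PSum i j L}"
| "operands (Other R x) = R"

fun result :: "operation \<Rightarrow> word" where
  "result (Zero i j) = PSum i j {}"
| "result (Mul i k j) = PSum i j {k}"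
| "result (Fma i k j K) = PSum i j (insert k K)"
| "result (Add i j K L) = PSum i j (K \<union> L)"
| "result (Other R x) = Aux x"

text \<open>The side conditions ensure that no product enters a sum twice.\<close>

fun legal :: "operation \<Rightarrow> bool" where
  "legal (Fma i k j K) \<longleftrightarrow> k \<notin> K"
| "legal (Add i j K L) \<longleftrightarrow> K \<inter> L = {}"
| "legal _ \<longleftrightarrow> True"

fun computes_product :: "nat \<Rightarrow> nat \<Rightarrow> nat \<Rightarrow> operation \<Rightarrow> bool" where
  "computes_product i k j (Mul i' k' j') \<longleftrightarrow> (i', k', j') = (i, k, j)"
| "computes_product i k j (Fma i' k' j' K) \<longleftrightarrow> (i', k', j') = (i, k, j)"
| "computes_product i k j _ \<longleftrightarrow> False"

text \<open>The number a symbolic word stands for; \<open>g\<close> interprets the auxiliary words.\<close>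

fun word_value ::
  "(nat \<Rightarrow> nat \<Rightarrow> 'a::comm_semiring_1) \<Rightarrow> (nat \<Rightarrow> nat \<Rightarrow> 'a) \<Rightarrow> (nat \<Rightarrow> 'a) \<Rightarrow> word \<Rightarrow> 'a" where
  "word_value A B g (InA i k) = A i k"
| "word_value A B g (InB k j) = B k j"
| "word_value A B g (PSum i j K) = (\<Sum>k\<in>K. A i k * B k j)"
| "word_value A B g (Aux x) = g x"

lemma word_value_result:
  "word_value A B g (result (Zero i j)) = 0"
  "word_value A B g (result (Mul i k j)) =
     word_value A B g (InA i k) * word_value A B g (InB k j)"
  "finite K \<Longrightarrow> legal (Fma i k j K) \<Longrightarrow>
     word_value A B g (result (Fma i k j K)) =
     word_value A B g (PSum i j K) + word_value A B g (InA i k) * word_value A B g (InB k j)"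
  "finite K \<Longrightarrow> finite L \<Longrightarrow> legal (Add i j K L) \<Longrightarrow>
     word_value A B g (result (Add i j K L)) =
     word_value A B g (PSum i j K) + word_value A B g (PSum i j L)"
  by (simp_all add: sum.union_disjoint add.commute)

text \<open>
  \<open>Load\<close> and \<open>Store\<close> copy one word across the boundary. \<open>Fire f D\<close> performs \<open>f\<close> at a station;
  the words in \<open>D\<close> are released as the result is written, so that a result may overwrite an
  operand.
\<close>

datatype step =
    Load word
  | Store word
  | Discard word
  | Fire operation "word set"

type_synonym state = "word set \<times> word set"   \<comment> \<open>(fast level, slow level)\<close>

inductive transition :: "nat \<Rightarrow> state \<Rightarrow> step \<Rightarrow> state \<Rightarrow> bool" for S :: nat where
  load: "x \<in> slow \<Longrightarrow> card (insert x fast) \<le> S \<Longrightarrow>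
    transition S (fast, slow) (Load x) (insert x fast, slow)"
| store: "x \<in> fast \<Longrightarrow>
    transition S (fast, slow) (Store x) (fast, insert x slow)"
| discard:
    "transition S (fast, slow) (Discard x) (fast - {x}, slow)"
| fire: "legal f \<Longrightarrow> operands f \<subseteq> fast \<Longrightarrow> card (insert (result f) (fast - D)) \<le> S \<Longrightarrow>
    transition S (fast, slow) (Fire f D) (insert (result f) (fast - D), slow)"

inductive run :: "nat \<Rightarrow> state \<Rightarrow> step list \<Rightarrow> state \<Rightarrow> bool" for S :: nat where
  run_Nil: "run S s [] s"
| run_Cons: "transition S s x s' \<Longrightarrow> run S s' xs s'' \<Longrightarrow> run S s (x # xs) s''"

definition inputs :: "nat \<Rightarrow> word set" where
  "inputs n = {InA i k | i k. i < n \<and> k < n} \<union> {InB k j | k j. k < n \<and> j < n}"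

definition outputs :: "nat \<Rightarrow> word set" where
  "outputs n = {PSum i j {..<n} | i j. i < n \<and> j < n}"

text \<open>
  The run starts with the inputs in the slow level and an empty fast level. The outputs may be left
  at either level.
\<close>

definition matmul_run :: "nat \<Rightarrow> nat \<Rightarrow> step list \<Rightarrow> state \<Rightarrow> bool" where
  "matmul_run n S sched final \<longleftrightarrow>
     run S ({}, inputs n) sched final \<and>
     (\<forall>i<n. \<forall>k<n. \<forall>j<n. \<exists>f D. Fire f D \<in> set sched \<and> computes_product i k j f) \<and>
     outputs n \<subseteq> fst final \<union> snd final"

fun crosses :: "step \<Rightarrow> bool" where
  "crosses (Load x) \<longleftrightarrow> True"
| "crosses (Store x) \<longleftrightarrow> True"
| "crosses _ \<longleftrightarrow> False"

definition word_crossings :: "step list \<Rightarrow> nat" where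
  "word_crossings sched = length (filter crosses sched)"

definition bit_crossings :: "nat \<Rightarrow> step list \<Rightarrow> nat" where
  "bit_crossings w sched = w * word_crossings sched"

definition fare :: "real \<Rightarrow> nat \<Rightarrow> step list \<Rightarrow> real" where
  "fare c\<^sub>0 w sched = c\<^sub>0 * real (bit_crossings w sched)"

end

theory Submission
  imports Defs "HOL-Analysis.Convex"
begin

text \<open>
  For the lower bound, call \<open>(i, k, j)\<close> covered once one of the two levels holds a partial
  sum of \<open>C i j\<close> that includes the \<open>k\<close>-th product. If it becomes covered during a segment of the run, then within this segment
  \<open>A i k\<close> and \<open>B k j\<close> were at the fast level, and a partial sum of \<open>C i j\<close> stays fast at its end or
  was stored. In a segment of \<open>S\<close> crossings each of these three families has at most \<open>2 S\<close>
  members, so by the Loomis--Whitney inequality at most \<open>sqrt (8 S\<^sup>3)\<close> triples become covered, while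
  all \<open>n\<^sup>3\<close> have to be. A run of \<open>Q < S\<close> crossings is one segment; it starts with an empty fast
  level, which gives \<open>n\<^sup>6 \<le> Q\<^sup>2 (S + Q)\<close>.

  For the upper bound, \<open>b \<times> b\<close> blocks of \<open>C\<close> with \<open>b\<close> of order \<open>sqrt S\<close> are accumulated at the fast
  level by rank-one updates.
\<close>

section \<open>Lower bound\<close>

definition covered :: "word set \<Rightarrow> (nat \<times> nat \<times> nat) set" where
  "covered W = {(i, k, j). \<exists>K. PSum i j K \<in> W \<and> k \<in> K}"

text \<open>Slice \<open>V\<close> into fibres \<open>T z\<close> over \<open>z\<close> in
  \<open>Z\<close>. Cauchy--Schwarz bounds \<open>card V ^ 2\<close> by \<open>card Z\<close> times
  the number of pairs \<open>k\<close>, \<open>k'\<close> in a common fibre, and such a pair over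
  \<open>(i, j)\<close> is recorded injectively by \<open>(i, k)\<close> in \<open>X\<close> and
  \<open>(k', j)\<close> in \<open>Y\<close>.\<close>

lemma loomis_whitney:
  fixes X :: "('a \<times> 'b) set" and Y :: "('b \<times> 'c) set" and Z :: "('a \<times> 'c) set"
  assumes "finite X" "finite Y" "finite Z"
    and V: "V \<subseteq> {(i, k, j). (i, k) \<in> X \<and> (k, j) \<in> Y \<and> (i, j) \<in> Z}"
  shows "finite V" and "card V ^ 2 \<le> card X * card Y * card Z"
proof -
  define T where "T z = {k. (fst z, k, snd z) \<in> V}" for z
  have V': "(i, k) \<in> X" "(k, j) \<in> Y" "(i, j) \<in> Z" if "(i, k, j) \<in> V" for i k j
    using V that by auto
  have T: "finite (T z)" for z
  proof (rule finite_subset)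
    show "T z \<subseteq> snd ` X"
      using V'(1) by (metis (mono_tags, lifting) T_def image_eqI mem_Collect_eq snd_conv subsetI)
  qed (use assms in simp)
  have V_eq: "V = (\<lambda>(z, k). (fst z, k, snd z)) ` Sigma Z T"
  proof (intro equalityI subsetI)
    fix v
    assume "v \<in> V"
    moreover obtain i k j where "v = (i, k, j)"
      by (cases v)
    ultimately show "v \<in> (\<lambda>(z, k). (fst z, k, snd z)) ` Sigma Z T"
      using V'(3) by (intro image_eqI[of _ _ "((i, j), k)"]) (auto simp: T_def)
  qed (auto simp: T_def)
  have "finite (Sigma Z T)"
    by (intro finite_SigmaI assms T)
  then show "finite V"
    by (subst V_eq) (rule finite_imageI)
  have inj: "inj_on (\<lambda>(z, k). (fst z, k, snd z)) (Sigma Z T)"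
    by (auto simp: inj_on_def)
  have "card V = (\<Sum>z\<in>Z. card (T z))"
    using card_image[OF inj] card_SigmaI[OF assms(3), of T] T V_eq by metis
  then have "real (card V) ^ 2 = (\<Sum>z\<in>Z. 1 * real (card (T z))) ^ 2"
    by simp
  also have "\<dots> \<le> (\<Sum>z\<in>Z. 1 ^ 2) * (\<Sum>z\<in>Z. real (card (T z)) ^ 2)"
    by (rule Cauchy_Schwarz_ineq_sum)
  also have "\<dots> = real (card Z * (\<Sum>z\<in>Z. card (T z \<times> T z)))"
    by (simp add: card_cartesian_product power2_eq_square)
  finally have 1: "card V ^ 2 \<le> card Z * (\<Sum>z\<in>Z. card (T z \<times> T z))"
    by (simp only: of_nat_power[symmetric] of_nat_le_iff)
  have "(\<Sum>z\<in>Z. card (T z \<times> T z)) = card (SIGMA z:Z. T z \<times> T z)"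
    by (rule card_SigmaI[symmetric]) (auto intro: T assms)
  also have "\<dots> \<le> card (X \<times> Y)"
  proof (rule card_inj_on_le)
    show "inj_on (\<lambda>(z, k, k'). ((fst z, k), (k', snd z))) (SIGMA z:Z. T z \<times> T z)"
      by (auto simp: inj_on_def)
    show "(\<lambda>(z, k, k'). ((fst z, k), (k', snd z))) ` (SIGMA z:Z. T z \<times> T z) \<subseteq> X \<times> Y"
      using V'(1,2) by (auto simp: T_def)
  qed (use assms in simp)
  finally have "card Z * (\<Sum>z\<in>Z. card (T z \<times> T z)) \<le> card Z * card (X \<times> Y)"
    by (rule mult_le_mono2)
  then have "card V ^ 2 \<le> card Z * card (X \<times> Y)"
    by (rule order_trans[OF 1])
  then show "card V ^ 2 \<le> card X * card Y * card Z"
    by (simp only: card_cartesian_product mult.commute)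
qed

section \<open>How a triple becomes covered\<close>

lemma transition_fresh:
  assumes "transition S s x s'"
    and "(i, k, j) \<in> covered (fst s' \<union> snd s')" "(i, k, j) \<notin> covered (fst s \<union> snd s)"
  shows "InA i k \<in> fst s \<and> InB k j \<in> fst s \<and> (\<exists>f D. x = Fire f D \<and> computes_product i k j f)"
  using assms
proof (cases rule: transition.cases)
  \<comment> \<open>\<open>Zero\<close> and \<open>Other\<close> cover nothing, and
    \<open>Add\<close> covers only what its resident operands cover already; so a fresh triple comes
    from \<open>Mul\<close> or \<open>Fma\<close>, with both factors resident.\<close>
  case (fire f fast D slow)
  then show ?thesis
    using assms(2,3) by (cases f) (auto simp: covered_def)
qed (auto simp: covered_def)

lemma transition_inputs:
  assumes "transition S s x s'"
  shows "(InA i k \<in> fst s' \<longrightarrow> InA i k \<in> fst s \<or> x = Load (InA i k)) \<and>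
    (InB k j \<in> fst s' \<longrightarrow> InB k j \<in> fst s \<or> x = Load (InB k j))"
  using assms
proof (cases rule: transition.cases)
  case (fire f fast D slow)
  then show ?thesis
    by (cases f) auto
qed auto

text \<open>Look at the first step after which the triple is covered: it fires the product with both
  factors resident. No operation produces an input word, so each factor was resident from the start
  or loaded. The last conjunct serves the upper bound, where it shows that all products are
  computed.\<close>

lemma run_fresh:
  assumes "run S s xs s'"
    and "(i, k, j) \<in> covered (fst s' \<union> snd s')" "(i, k, j) \<notin> covered (fst s \<union> snd s)"
  shows "InA i k \<in> fst s \<union> {x. Load x \<in> set xs} \<and> InB k j \<in> fst s \<union> {x. Load x \<in> set xs} \<and>
    (\<exists>f D. Fire f D \<in> set xs \<and> computes_product i k j f)"
  using assms
proof (induction rule: run.induct)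
  case (run_Cons s x s' xs s'')
  show ?case
  proof (cases "(i, k, j) \<in> covered (fst s' \<union> snd s')")
    case True
    then show ?thesis
      using transition_fresh[OF run_Cons.hyps(1) True run_Cons.prems(2)]
      by (metis UnI1 list.set_intros(1))
  next
    case False
    then show ?thesis
      using run_Cons.IH[OF run_Cons.prems(1) False] transition_inputs[OF run_Cons.hyps(1), of i k j]
      by (simp only: Un_iff mem_Collect_eq list.set insert_iff) blast
  qed
qed simp

lemma run_slow:
  "run S s xs s' \<Longrightarrow> snd s' \<subseteq> snd s \<union> {x. Store x \<in> set xs}"
proof (induction rule: run.induct)
  case (run_Cons s x s' xs s'')
  have "snd s' \<subseteq> snd s \<union> {y. x = Store y}"
    using run_Cons.hyps(1) by cases auto
  then show ?case
    using run_Cons.IH by auto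
qed simp

text \<open>Finiteness is part of the invariant because \<open>card\<close> of an infinite set is 0,
  so the capacity check alone does not give it.\<close>

lemma run_fast:
  "run S s xs s' \<Longrightarrow> finite (fst s) \<Longrightarrow> card (fst s) \<le> S \<Longrightarrow> finite (fst s') \<and> card (fst s') \<le> S"
proof (induction rule: run.induct)
  case (run_Cons s x s' xs s'')
  have "finite (fst s') \<and> card (fst s') \<le> S"
    using run_Cons.hyps(1)
    by cases (use run_Cons.prems in \<open>auto intro: le_trans[OF card_Diff1_le]\<close>)
  then show ?case
    using run_Cons.IH by simp
qed simp

lemma run_append: "run S s xs s' \<Longrightarrow> run S s' ys s'' \<Longrightarrow> run S s (xs @ ys) s''"
  by (induction rule: run.induct) (auto intro: run.intros)

lemma run_appendE:
  assumes "run S s (xs @ ys) s''"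
  obtains s' where "run S s xs s'" "run S s' ys s''"
  using assms
proof (induction xs arbitrary: s thesis)
  case (Cons x xs)
  from Cons.prems(2) obtain t where "transition S s x t" "run S t (xs @ ys) s''"
    by (auto elim: run.cases)
  then show ?case
    using Cons by (metis run_Cons)
qed (auto intro: run_Nil)

section \<open>Counting fresh triples by crossings\<close>

lemma card_transferred:
  "card {x. Load x \<in> set xs} \<le> word_crossings xs" "card {x. Store x \<in> set xs} \<le> word_crossings xs"
  "finite {x. Load x \<in> set xs}" "finite {x. Store x \<in> set xs}"
proof -
  \<comment> \<open>The value on other steps is left open; \<open>wd\<close> is applied only to
    steps that pass the filter \<open>crosses\<close>.\<close>
  define wd where "wd s = (case s of Load x \<Rightarrow> x | Store x \<Rightarrow> x)" for s
  have sub: "{x. Load x \<in> set xs} \<subseteq> set (map wd (filter crosses xs))"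
    "{x. Store x \<in> set xs} \<subseteq> set (map wd (filter crosses xs))"
    by (force simp: wd_def)+
  have "card (set (map wd (filter crosses xs))) \<le> word_crossings xs"
    unfolding word_crossings_def by (metis card_length length_map)
  then show "card {x. Load x \<in> set xs} \<le> word_crossings xs"
    "card {x. Store x \<in> set xs} \<le> word_crossings xs"
    using sub by (meson List.finite_set card_mono le_trans)+
  show "finite {x. Load x \<in> set xs}" "finite {x. Store x \<in> set xs}"
    using sub finite_subset by blast+
qed

lemma finite_card_vimage_le:
  assumes "finite W" "inj f"
  shows "finite (f -` W)" "card (f -` W) \<le> card W"
  using assms by (auto intro: finite_vimageI card_inj_on_le[of f] inj_on_subset)

text \<open>Loomis--Whitney with the factors drawn from \<open>R\<close> (resident at the start or
  loaded) and the sums from \<open>P\<close> (resident at the end or stored). Keeping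
  \<open>card (fst s)\<close> instead of \<open>S\<close> in the bound for \<open>R\<close> pays off
  when the fast level starts empty.\<close>

lemma run_segment:
  assumes run: "run S s xs s'" and s: "finite (fst s)" "card (fst s) \<le> S"
  defines "V \<equiv> covered (fst s' \<union> snd s') - covered (fst s \<union> snd s)"
  shows "finite V" and "card V ^ 2 \<le> (card (fst s) + word_crossings xs) ^ 2 * (S + word_crossings xs)"
proof -
  define R where "R = fst s \<union> {x. Load x \<in> set xs}"
  define P where "P = fst s' \<union> {x. Store x \<in> set xs}"
  define X where "X = (\<lambda>(i, k). InA i k) -` R"
  define Y where "Y = (\<lambda>(k, j). InB k j) -` R"
  \<comment> \<open>Words that are not partial sums go to an unspecified pair; this can only enlarge
    \<open>Z\<close>, which stays within \<open>card P\<close>.\<close>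
  define Z where "Z = (\<lambda>w. case w of PSum i j K \<Rightarrow> (i, j)) ` P"
  have R: "finite R" "card R \<le> card (fst s) + word_crossings xs"
    unfolding R_def using s card_transferred[of xs]
    by (auto intro: order_trans[OF card_Un_le] simp: add_mono)
  have P: "finite P" "card P \<le> S + word_crossings xs"
    unfolding P_def using run_fast[OF run s] card_transferred[of xs]
    by (auto intro!: order_trans[OF card_Un_le] simp: add_mono)
  have X: "finite X" "card X \<le> card R" and Y: "finite Y" "card Y \<le> card R"
    unfolding X_def Y_def by (rule finite_card_vimage_le; use R in \<open>simp add: inj_def\<close>)+
  have Z: "finite Z" "card Z \<le> card P"
    unfolding Z_def using P by (auto intro: card_image_le)
  have "V \<subseteq> {(i, k, j). (i, k) \<in> X \<and> (k, j) \<in> Y \<and> (i, j) \<in> Z}"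
  proof clarify
    fix i k j
    assume v: "(i, k, j) \<in> V"
    \<comment> \<open>As the triple was not covered at the start, this sum was not in the slow level
      then; if it is there at the end, it was stored in between.\<close>
    then obtain K where K: "PSum i j K \<in> fst s' \<union> snd s'" "k \<in> K" "PSum i j K \<notin> snd s"
      by (auto simp: V_def covered_def)
    then have "PSum i j K \<in> P"
      using run_slow[OF run] by (auto simp: P_def)
    then have "(i, j) \<in> Z"
      by (force simp: Z_def)
    then show "(i, k) \<in> X \<and> (k, j) \<in> Y \<and> (i, j) \<in> Z"
      using run_fresh[OF run, of i k j] v by (auto simp: V_def X_def Y_def R_def)
  qed
  note * = loomis_whitney[OF X(1) Y(1) Z(1) this]
  show "finite V" by (rule *)
  have "card X * card Y * card Z \<le> card R * card R * card P"
    using X Y Z by (intro mult_le_mono) auto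
  also have "\<dots> \<le> (card (fst s) + word_crossings xs) * (card (fst s) + word_crossings xs) * (S + word_crossings xs)"
    using R P by (intro mult_le_mono) auto
  finally show "card V ^ 2 \<le> (card (fst s) + word_crossings xs) ^ 2 * (S + word_crossings xs)"
    using *(2) by (simp add: power2_eq_square)
qed

lemma split_length_filter:
  "m \<le> length (filter Q xs) \<Longrightarrow> \<exists>ys zs. xs = ys @ zs \<and> length (filter Q ys) = m"
proof (induction xs arbitrary: m)
  case (Cons x xs)
  show ?case
  proof (cases m)
    case (Suc m')
    define m'' where "m'' = (if Q x then m' else m)"
    have "m'' \<le> length (filter Q xs)"
      using Cons.prems Suc by (auto simp: m''_def split: if_splits)
    from Cons.IH[OF this] obtain ys zs where "xs = ys @ zs" "length (filter Q ys) = m''"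
      by auto
    then show ?thesis
      using Suc by (intro exI[of _ "x # ys"] exI[of _ zs]) (auto simp: m''_def)
  qed (auto intro: exI[of _ "[]"])
qed auto

text \<open>Strong induction on the crossings: cut off a prefix with exactly \<open>S\<close> of
  them. This yields \<open>word_crossings xs div S\<close> full segments and a last one with fewer
  than \<open>S\<close> crossings.\<close>

lemma run_segments:
  assumes "run S s xs s'" "finite (fst s)" "card (fst s) \<le> S" "0 < S"
  defines "V \<equiv> covered (fst s' \<union> snd s') - covered (fst s \<union> snd s)"
  shows "finite V \<and> real (card V) \<le> real (word_crossings xs div S + 1) * sqrt (8 * real S ^ 3)"
  using assms(1-3) unfolding V_def
proof (induction "word_crossings xs" arbitrary: s xs rule: less_induct)
  case less
  \<comment> \<open>With at most \<open>S\<close> words resident and \<open>q \<le> S\<close>, the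
    segment bound is at most \<open>(2 * S) ^ 2 * (2 * S)\<close>, that is
    \<open>8 * S ^ 3\<close>.\<close>
  have seg: "real (card V) \<le> sqrt (8 * real S ^ 3)"
    if "card V ^ 2 \<le> (card (fst s) + q) ^ 2 * (S + q)" "q \<le> S" for V :: "(nat \<times> nat \<times> nat) set" and q
  proof -
    have "(card (fst s) + q) ^ 2 * (S + q) \<le> (2 * S) ^ 2 * (2 * S)"
      using that less.prems by (intro mult_le_mono power_mono) auto
    then have "card V ^ 2 \<le> 8 * S ^ 3"
      using that by (simp add: power2_eq_square power3_eq_cube)
    then have "real (card V ^ 2) \<le> real (8 * S ^ 3)"
      by (simp only: of_nat_le_iff)
    then have "real (card V) ^ 2 \<le> 8 * real S ^ 3"
      by simp
    then show ?thesis
      by (rule real_le_rsqrt)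
  qed
  show ?case
  proof (cases "word_crossings xs < S")
    case True
    then show ?thesis
      using run_segment[OF less.prems] seg[of _ "word_crossings xs"] by simp
  next
    case False
    then obtain ys zs where xs: "xs = ys @ zs" and ys: "word_crossings ys = S"
      using split_length_filter[of S crosses xs] by (auto simp: word_crossings_def)
    obtain t where t: "run S s ys t" "run S t zs s'"
      using less.prems(1) unfolding xs by (rule run_appendE)
    have q: "word_crossings xs = S + word_crossings zs"
      using ys by (simp add: xs word_crossings_def)
    let ?c = "\<lambda>s :: state. covered (fst s \<union> snd s)"
    have 1: "finite (?c t - ?c s)" "real (card (?c t - ?c s)) \<le> sqrt (8 * real S ^ 3)"
      using run_segment[OF t(1) less.prems(2,3)] ys seg[of _ S] by auto
    have "word_crossings zs < word_crossings xs" "finite (fst t)" "card (fst t) \<le> S"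
      using q \<open>0 < S\<close> run_fast[OF t(1) less.prems(2,3)] by simp_all
    note 2 = less.hyps[OF this(1) t(2) this(2,3)]
    \<comment> \<open>Coverage may be lost again by discarding, so only this inclusion holds in
      general; it suffices for adding up the segments.\<close>
    have sub: "?c s' - ?c s \<subseteq> (?c t - ?c s) \<union> (?c s' - ?c t)"
      by blast
    have "card (?c s' - ?c s) \<le> card (?c t - ?c s) + card (?c s' - ?c t)"
      by (rule order_trans[OF card_mono[OF _ sub] card_Un_le]) (use 1 2 in simp)
    then have "real (card (?c s' - ?c s)) \<le>
        real (1 + (word_crossings zs div S + 1)) * sqrt (8 * real S ^ 3)"
      using 1 2 by (simp add: algebra_simps)
    moreover have "word_crossings xs div S = word_crossings zs div S + 1"
      using q \<open>0 < S\<close> by simp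
    ultimately show ?thesis
      using finite_subset[OF sub] 1 2 by simp
  qed
qed

section \<open>The lower bound on crossings\<close>

lemma covered_outputs:
  assumes "outputs n \<subseteq> W" "i < n" "k < n" "j < n"
  shows "(i, k, j) \<in> covered W"
  using assms by (auto simp: covered_def outputs_def)

lemma covered_inputs: "covered (inputs n) = {}"
  by (auto simp: covered_def inputs_def)

lemma matmul_crossings_lower:
  assumes "matmul_run n S sched final"
  shows "real n ^ 3 / sqrt (real S) \<le> 8 * real (word_crossings sched)"
proof (cases "S = 0")
  case False
  define Q where "Q = word_crossings sched"
  define V where "V = covered (fst final \<union> snd final)"
  have run: "run S ({}, inputs n) sched final" and out: "outputs n \<subseteq> fst final \<union> snd final"
    using assms by (auto simp: matmul_run_def)
  have box: "{..<n} \<times> {..<n} \<times> {..<n} \<subseteq> V"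
    using covered_outputs[OF out] by (auto simp: V_def)
  have "finite V"
    and V1: "card V ^ 2 \<le> Q ^ 2 * (S + Q)"
    and V2: "real (card V) \<le> real (Q div S + 1) * sqrt (8 * real S ^ 3)"
    using run_segment[OF run] run_segments[OF run] False
    by (auto simp: V_def Q_def covered_inputs)
  then have n: "n ^ 3 \<le> card V"
    using card_mono[OF _ box] by (simp add: card_cartesian_product power3_eq_cube)
  then have n': "real n ^ 3 \<le> real (card V)"
    by (simp only: of_nat_power[symmetric] of_nat_le_iff)
  have "real (card V) \<le> 8 * real Q * sqrt S"
  \<comment> \<open>For \<open>Q < S\<close> the segment count is 1 and its bound
    \<open>sqrt (8 * S ^ 3)\<close> contains no factor \<open>Q\<close>, so \<open>V1\<close> is
    used instead. The generous 64 makes the constant 8 the same in both cases.\<close>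
  proof (cases "Q < S")
    case True
    have "real (card V ^ 2) \<le> real (Q ^ 2 * (S + Q))"
      using V1 by (simp only: of_nat_le_iff)
    then have "real (card V) ^ 2 \<le> real Q ^ 2 * (real S + real Q)"
      by simp
    also have "\<dots> \<le> real Q ^ 2 * (64 * real S)"
      using True by (intro mult_left_mono) auto
    also have "\<dots> = (8 * real Q * sqrt S) ^ 2"
      by (simp add: power_mult_distrib)
    finally show ?thesis
      by (rule power2_le_imp_le) simp
  next
    case qS: False
    have "S * (Q div S) \<le> Q"
      by (rule times_div_less_eq_dividend)
    then have "S * (Q div S + 1) \<le> 2 * Q"
      unfolding distrib_left using qS by linarith
    then have "real (S * (Q div S + 1)) \<le> real (2 * Q)"
      by (simp only: of_nat_le_iff)
    then have 1: "real (Q div S + 1) * real S \<le> 2 * real Q"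
      by (simp add: algebra_simps)
    \<comment> \<open>Here \<open>sqrt 8\<close> is rounded up to 4; with the factor 2 from the
      rounding of \<open>Q div S + 1\<close> this gives 8.\<close>
    have "sqrt (8 * real S ^ 3) \<le> 4 * real S * sqrt S"
    proof (rule real_le_lsqrt)
      show "8 * real S ^ 3 \<le> (4 * real S * sqrt S)\<^sup>2"
        by (simp add: power_mult_distrib power2_eq_square power3_eq_cube)
    qed simp
    then have "real (Q div S + 1) * sqrt (8 * real S ^ 3) \<le> real (Q div S + 1) * (4 * real S * sqrt S)"
      by (rule mult_left_mono) simp
    also have "\<dots> = 4 * (real (Q div S + 1) * real S) * sqrt S"
      by (simp only: mult_ac)
    also have "\<dots> \<le> 4 * (2 * real Q) * sqrt S"
      by (intro mult_right_mono mult_left_mono 1) simp_all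
    finally show ?thesis
      using V2 by simp
  qed
  then have "real n ^ 3 \<le> 8 * real Q * sqrt S"
    by (rule order_trans[OF n'])
  then show ?thesis
    using False by (simp only: divide_simps Q_def) simp
\<comment> \<open>For \<open>S = 0\<close> the left side is a division by \<open>sqrt 0 = 0\<close>,
  hence 0.\<close>
qed simp

section \<open>Blocked schedule\<close>

definition reach :: "nat \<Rightarrow> state \<Rightarrow> nat \<Rightarrow> state \<Rightarrow> bool" where
  "reach S s q s' \<longleftrightarrow> (\<exists>xs. run S s xs s' \<and> word_crossings xs \<le> q)"

lemma reach_refl: "reach S s 0 s"
  unfolding reach_def by (rule exI[of _ "[]"]) (simp add: run_Nil word_crossings_def)

lemma reach_step: "transition S s x s' \<Longrightarrow> reach S s (if crosses x then 1 else 0) s'"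
  unfolding reach_def
  by (rule exI[of _ "[x]"]) (auto intro: run.intros simp: word_crossings_def)

lemma reach_trans [trans]:
  assumes "reach S s p t" "reach S t q u"
  shows "reach S s (p + q) u"
proof -
  obtain xs ys where "run S s xs t" "word_crossings xs \<le> p" "run S t ys u" "word_crossings ys \<le> q"
    using assms by (auto simp: reach_def)
  then show ?thesis
    unfolding reach_def
    by (intro exI[of _ "xs @ ys"]) (auto intro: run_append simp: word_crossings_def)
qed

lemma reach_mono: "reach S s p t \<Longrightarrow> p \<le> q \<Longrightarrow> reach S s q t"
  unfolding reach_def by (meson order_trans)

lemma reach_load: "x \<in> L \<Longrightarrow> card (insert x F) \<le> S \<Longrightarrow> reach S (F, L) 1 (insert x F, L)"
  using reach_step[OF transition.load] by simp

lemma reach_store: "x \<in> F \<Longrightarrow> reach S (F, L) 1 (F, insert x L)"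
  using reach_step[OF transition.store] by simp

lemma reach_discard: "reach S (F, L) 0 (F - {x}, L)"
  using reach_step[OF transition.discard] by simp

lemma reach_fire:
  "legal f \<Longrightarrow> operands f \<subseteq> F \<Longrightarrow> card (insert (result f) (F - D)) \<le> S \<Longrightarrow>
    reach S (F, L) 0 (insert (result f) (F - D), L)"
  using reach_step[OF transition.fire] by simp

lemma reach_iterate:
  assumes "\<And>k. k < m \<Longrightarrow> reach S (st k) q (st (Suc k))"
  shows "reach S (st 0) (m * q) (st m)"
  using assms
proof (induction m)
  case (Suc m)
  then have "reach S (st 0) (m * q + q) (st (Suc m))"
    by (intro reach_trans[of S _ _ "st m"]) simp_all
  then show ?case
    by (simp add: add.commute)
qed (simp add: reach_refl)

text \<open>A loop whose states are indexed by the set already processed: no enumeration of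
  \<open>X\<close> has to be fixed, since the step is available from every subset.\<close>

lemma reach_iterate_set:
  assumes "finite X"
    and step: "\<And>x Y. Y \<subseteq> X \<Longrightarrow> x \<in> X \<Longrightarrow> x \<notin> Y \<Longrightarrow> reach S (st Y) q (st (insert x Y))"
  shows "reach S (st {}) (card X * q) (st X)"
proof -
  have "reach S (st {}) (card Y * q) (st Y)" if "finite Y" "Y \<subseteq> X" for Y
    using that
  proof (induction Y rule: finite_induct)
    case (insert x Y)
    then have "reach S (st {}) (card Y * q + q) (st (insert x Y))"
      by (intro reach_trans[of S _ _ "st Y"] step) simp_all
    then show ?case
      using insert.hyps by (simp add: add.commute)
  qed (simp add: reach_refl)
  then show ?thesis
    using assms(1) by simp
qed

lemma reach_loads:
  assumes "finite X" "finite F" "X \<subseteq> L" "card (X \<union> F) \<le> S"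
  shows "reach S (F, L) (card X) (X \<union> F, L)"
proof -
  have "reach S ({} \<union> F, L) (card X * 1) (X \<union> F, L)"
  proof (rule reach_iterate_set[where st = "\<lambda>Y. (Y \<union> F, L)"])
    fix x Y
    assume Y: "Y \<subseteq> X" "x \<in> X" "x \<notin> Y"
    have "card (insert x (Y \<union> F)) \<le> card (X \<union> F)"
      using assms Y by (intro card_mono) auto
    then have "reach S (Y \<union> F, L) 1 (insert x (Y \<union> F), L)"
      using assms Y by (intro reach_load) auto
    then show "reach S (Y \<union> F, L) 1 (insert x Y \<union> F, L)"
      by simp
  qed (rule assms)
  then show ?thesis
    by simp
qed

lemma reach_stores:
  assumes "finite X" "X \<subseteq> F"
  shows "reach S (F, L) (card X) (F, L \<union> X)"
proof -
  have "reach S (F, L \<union> {}) (card X * 1) (F, L \<union> X)"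
  proof (rule reach_iterate_set[where st = "\<lambda>Y. (F, L \<union> Y)"])
    fix x Y
    assume "Y \<subseteq> X" "x \<in> X" "x \<notin> Y"
    then show "reach S (F, L \<union> Y) 1 (F, L \<union> insert x Y)"
      using reach_store[of x F S "L \<union> Y"] assms by auto
  qed (rule assms)
  then show ?thesis
    by simp
qed

lemma reach_discards:
  assumes "finite X"
  shows "reach S (F, L) 0 (F - X, L)"
proof -
  have "reach S (F - {}, L) (card X * 0) (F - X, L)"
  proof (rule reach_iterate_set[where st = "\<lambda>Y. (F - Y, L)"])
    fix x Y
    show "reach S (F - Y, L) 0 (F - insert x Y, L)"
      unfolding Diff_insert[of F x Y] by (rule reach_discard)
  qed (rule assms)
  then show ?thesis
    by simp
qed

section \<open>Accumulating one block of the product\<close>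

text \<open>The block \<open>P\<close> in the middle of update \<open>k\<close>: the entries in
  \<open>Q\<close> have received their \<open>k\<close>-th product, the others have not. An update
  leads from \<open>Q = {}\<close> to \<open>Q = P\<close>, which is the start of update
  \<open>Suc k\<close>.\<close>

definition accumulators :: "nat \<Rightarrow> (nat \<times> nat) set \<Rightarrow> (nat \<times> nat) set \<Rightarrow> word set" where
  "accumulators k P Q = (\<lambda>(i, j). PSum i j (if (i, j) \<in> Q then {..<Suc k} else {..<k})) ` P"

lemma accumulators_simps:
  "PSum i j K \<in> accumulators k P Q \<longleftrightarrow>
     (i, j) \<in> P \<and> K = (if (i, j) \<in> Q then {..<Suc k} else {..<k})"
  "InA i l \<notin> accumulators k P Q" "InB l j \<notin> accumulators k P Q" "Aux x \<notin> accumulators k P Q"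
  unfolding accumulators_def image_iff Bex_def split_paired_Ex prod.case by auto

lemma accumulators_all: "accumulators k P P = accumulators (Suc k) P {}"
  by (force simp: accumulators_def)

lemma accumulators_finite:
  assumes "finite P"
  shows "finite (accumulators k P Q)" "card (accumulators k P Q) \<le> card P"
  unfolding accumulators_def using assms by (auto intro: card_image_le)

text \<open>The new sum overwrites the old one, so the accumulators never exceed
  \<open>card P\<close> words. As \<open>F\<close> contains no partial sum, releasing the operand
  leaves \<open>F\<close> intact.\<close>

lemma reach_fma:
  assumes P: "finite P" "(i, j) \<in> P" "(i, j) \<notin> Q"
    and F: "finite F" "InA i k \<in> F" "InB k j \<in> F" "\<And>i j K. PSum i j K \<notin> F"
    and S: "card F + card P \<le> S"
  shows "reach S (F \<union> accumulators k P Q, L) 0 (F \<union> accumulators k P (insert (i, j) Q), L)"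
proof -
  let ?f = "Fma i k j {..<k}" and ?D = "{PSum i j {..<k}}"
  have eq: "insert (result ?f) ((F \<union> accumulators k P Q) - ?D) =
      F \<union> accumulators k P (insert (i, j) Q)"
  proof (rule set_eqI)
    fix x
    show "x \<in> insert (result ?f) ((F \<union> accumulators k P Q) - ?D) \<longleftrightarrow>
        x \<in> F \<union> accumulators k P (insert (i, j) Q)"
      using P F by (cases x) (auto simp: accumulators_simps lessThan_Suc split: if_splits)
  qed
  have "card (F \<union> accumulators k P (insert (i, j) Q)) \<le> S"
    using accumulators_finite[OF P(1)] S by (meson add_mono card_Un_le le_refl le_trans)
  then have "reach S (F \<union> accumulators k P Q, L) 0
      (insert (result ?f) ((F \<union> accumulators k P Q) - ?D), L)"
    using P F by (intro reach_fire) (unfold eq, auto simp: accumulators_simps)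
  then show ?thesis
    by (simp only: eq)
qed

text \<open>The column piece of \<open>A\<close> stays resident while the row piece of
  \<open>B\<close> is streamed through a single word. This explains the \<open>1\<close> in the
  capacity condition and the \<open>card I + card J\<close> loads.\<close>

lemma reach_rank_one_update:
  assumes I: "finite I" and J: "finite J"
    and S: "card I + 1 + card I * card J \<le> S"
    and L: "\<And>i. i \<in> I \<Longrightarrow> InA i k \<in> L" "\<And>j. j \<in> J \<Longrightarrow> InB k j \<in> L"
  shows "reach S (accumulators k (I \<times> J) {}, L) (card I + card J)
    (accumulators (Suc k) (I \<times> J) {}, L)"
proof -
  let ?A = "(\<lambda>i. InA i k) ` I" and ?acc = "accumulators k (I \<times> J)"
  have A: "finite ?A" "card ?A = card I"
    using I by (auto intro: card_image simp: inj_on_def)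
  have acc: "finite (?acc Q)" "card (?acc Q) \<le> card I * card J" for Q
    using accumulators_finite[of "I \<times> J"] I J by (auto simp: card_cartesian_product)
  have card_le: "card (W \<union> ?acc Q) \<le> S" if "card W \<le> card I + 1" for W Q
    using that acc(2)[of Q] S card_Un_le[of W "?acc Q"] by linarith
  have column: "reach S (?A \<union> ?acc (I \<times> Y), L) 1 (?A \<union> ?acc (I \<times> insert j Y), L)"
    if j: "j \<in> J" "j \<notin> Y" for j Y
  proof -
    let ?F = "insert (InB k j) ?A"
    have F: "finite ?F" "card ?F = card I + 1"
      using A by (auto simp: card_insert_if)
    have "reach S (?A \<union> ?acc (I \<times> Y), L) 1 (insert (InB k j) (?A \<union> ?acc (I \<times> Y)), L)"
      using j L card_le[of ?F "I \<times> Y"] F by (intro reach_load) simp_all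
    \<comment> \<open>The empty product \<open>{} \<times> {j}\<close> puts the state into the form
      in which the loop over \<open>I\<close> starts.\<close>
    then have 1: "reach S (?A \<union> ?acc (I \<times> Y), L) 1 (?F \<union> ?acc (I \<times> Y \<union> {} \<times> {j}), L)"
      by simp
    have 2: "reach S (?F \<union> ?acc (I \<times> Y \<union> {} \<times> {j}), L) (card I * 0) (?F \<union> ?acc (I \<times> Y \<union> I \<times> {j}), L)"
    proof (rule reach_iterate_set[where st = "\<lambda>Z. (?F \<union> ?acc (I \<times> Y \<union> Z \<times> {j}), L)", OF I])
      fix i Z
      assume i: "Z \<subseteq> I" "i \<in> I" "i \<notin> Z"
      have "reach S (?F \<union> ?acc (I \<times> Y \<union> Z \<times> {j}), L) 0
        (?F \<union> ?acc (insert (i, j) (I \<times> Y \<union> Z \<times> {j})), L)"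
      proof (rule reach_fma)
        show "card ?F + card (I \<times> J) \<le> S"
          unfolding F(2) card_cartesian_product by (rule S)
      qed (use i j F(1) I J in auto)
      moreover have "insert (i, j) (I \<times> Y \<union> Z \<times> {j}) = I \<times> Y \<union> insert i Z \<times> {j}"
        by auto
      ultimately show "reach S (?F \<union> ?acc (I \<times> Y \<union> Z \<times> {j}), L) 0
          (?F \<union> ?acc (I \<times> Y \<union> insert i Z \<times> {j}), L)"
        by (simp only:)
    qed
    have "I \<times> Y \<union> I \<times> {j} = I \<times> insert j Y"
      by auto
    then have "?F \<union> ?acc (I \<times> Y \<union> I \<times> {j}) - {InB k j} = ?A \<union> ?acc (I \<times> insert j Y)"
      by (auto simp: accumulators_simps)
    then have 3: "reach S (?F \<union> ?acc (I \<times> Y \<union> I \<times> {j}), L) 0 (?A \<union> ?acc (I \<times> insert j Y), L)"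
      using reach_discard[of S "?F \<union> ?acc (I \<times> Y \<union> I \<times> {j})" L "InB k j"] by (simp only:)
    show ?thesis
      using reach_trans[OF reach_trans[OF 1 2] 3] by (simp only: mult_0_right add_0_right)
  qed
  have 1: "reach S (?acc {}, L) (card I) (?A \<union> ?acc (I \<times> {}), L)"
    using reach_loads[OF A(1) acc(1), of L "{}" S] card_le[of ?A] A L by auto
  have 2: "reach S (?A \<union> ?acc (I \<times> {}), L) (card J * 1) (?A \<union> ?acc (I \<times> J), L)"
    by (rule reach_iterate_set[where st = "\<lambda>Y. (?A \<union> ?acc (I \<times> Y), L)", OF J]) (rule column)
  have "?A \<union> ?acc (I \<times> J) - ?A = accumulators (Suc k) (I \<times> J) {}"
    by (auto simp: accumulators_all accumulators_simps)
  then have 3: "reach S (?A \<union> ?acc (I \<times> J), L) 0 (accumulators (Suc k) (I \<times> J) {}, L)"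
    using reach_discards[OF A(1), of S "?A \<union> ?acc (I \<times> J)" L] by (simp only:)
  show ?thesis
    using reach_trans[OF reach_trans[OF 1 2] 3] by (simp only: mult_1_right add_0_right)
qed

text \<open>\<open>Zero\<close> creates the accumulators at the fast level without a crossing, and
  they stay there through all \<open>n\<close> updates; each entry crosses once, when stored at the
  end.\<close>

lemma reach_block:
  assumes I: "finite I" and J: "finite J"
    and S: "card I + 1 + card I * card J \<le> S"
    and L: "\<And>i k. i \<in> I \<Longrightarrow> k < n \<Longrightarrow> InA i k \<in> L" "\<And>k j. k < n \<Longrightarrow> j \<in> J \<Longrightarrow> InB k j \<in> L"
  shows "reach S ({}, L) (n * (card I + card J) + card I * card J)
    ({}, L \<union> accumulators n (I \<times> J) {})"
proof -
  let ?acc = "\<lambda>k. accumulators k (I \<times> J) {}" and ?z = "\<lambda>(i, j). PSum i j {}"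
  have acc: "finite (?acc k)" "card (?acc k) \<le> card I * card J" for k
    using accumulators_finite[of "I \<times> J"] I J by (auto simp: card_cartesian_product)
  have "reach S (?z ` {}, L) (card (I \<times> J) * 0) (?z ` (I \<times> J), L)"
  proof (rule reach_iterate_set[where st = "\<lambda>P. (?z ` P, L)"])
    fix p P
    assume P: "P \<subseteq> I \<times> J" "p \<in> I \<times> J" "p \<notin> P"
    obtain i j where p: "p = (i, j)"
      by (cases p)
    have "card (?z ` insert p P) \<le> card (insert p P)"
      using P I J by (intro card_image_le) (meson finite.insertI finite_SigmaI finite_subset)
    also have "\<dots> \<le> card (I \<times> J)"
      using P I J by (intro card_mono) auto
    finally have "card (?z ` insert p P) \<le> S"
      using S by (simp add: card_cartesian_product)
    then show "reach S (?z ` P, L) 0 (?z ` insert p P, L)"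
      using reach_fire[of "Zero i j" "?z ` P" "{}" S L] by (simp add: p)
  qed (use I J in simp)
  then have 1: "reach S ({}, L) 0 (?acc 0, L)"
    by (simp add: accumulators_def)
  have 2: "reach S (?acc 0, L) (n * (card I + card J)) (?acc n, L)"
    by (rule reach_iterate[where st = "\<lambda>k. (?acc k, L)"])
      (use L in \<open>intro reach_rank_one_update I J S\<close>)
  have 3: "reach S (?acc n, L) (card I * card J) (?acc n, L \<union> ?acc n)"
    using reach_stores[OF acc(1) order_refl] acc(2) by (rule reach_mono)
  have 4: "reach S (?acc n, L \<union> ?acc n) 0 ({}, L \<union> ?acc n)"
    using reach_discards[OF acc(1)[of n], of S "?acc n" "L \<union> ?acc n"] by simp
  show ?thesis
    using reach_trans[OF reach_trans[OF reach_trans[OF 1 2] 3] 4] by simp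
qed

text \<open>A fused multiply-add needs three resident words; with two, the product overwrites its
  factors and is then added to a partial sum fetched from the slow level.\<close>

lemma reach_entry_two_words:
  assumes L: "\<And>k. k < n \<Longrightarrow> InA i k \<in> L \<and> InB k j \<in> L" and S: "2 \<le> S"
  shows "reach S ({}, L) (4 * n + 1) ({}, L \<union> (\<lambda>m. PSum i j {..<m}) ` {..n})"
proof -
  \<comment> \<open>The slow level never loses a word, so all earlier prefix sums remain. Each index
    costs three loads and one store; the extra 1 stores the initial zero.\<close>
  let ?L = "\<lambda>k. L \<union> (\<lambda>m. PSum i j {..<m}) ` {..k}"
  have step: "reach S ({}, ?L k) 4 ({}, ?L (Suc k))" if k: "k < n" for k
  proof -
    let ?A = "InA i k" and ?B = "InB k j" and ?C = "PSum i j {..<k}" and ?M = "PSum i j {k}"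
      and ?R = "PSum i j {..<Suc k}"
    have ne: "?C \<noteq> ?M"
      by auto
    have "reach S ({}, ?L k) 1 ({?A}, ?L k)"
      using L[OF k] S by (intro reach_load) auto
    also have "reach S ({?A}, ?L k) 1 ({?B, ?A}, ?L k)"
      using L[OF k] S by (intro reach_load) auto
    also have "reach S ({?B, ?A}, ?L k) 0 ({?M}, ?L k)"
      using reach_fire[of "Mul i k j" "{?B, ?A}" "{?B, ?A}" S] S by simp
    also have "reach S ({?M}, ?L k) 1 ({?C, ?M}, ?L k)"
      using S ne by (intro reach_load) auto
    also have "reach S ({?C, ?M}, ?L k) 0 ({?R}, ?L k)"
      using reach_fire[of "Add i j {..<k} {k}" "{?C, ?M}" "{?C, ?M}" S] S by (simp add: lessThan_Suc)
    also have "reach S ({?R}, ?L k) 1 ({?R}, insert ?R (?L k))"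
      by (rule reach_store) simp
    also have "reach S ({?R}, insert ?R (?L k)) 0 ({}, insert ?R (?L k))"
      using reach_discard[of S "{?R}" _ ?R] by simp
    finally show ?thesis
      by (simp add: atMost_Suc numeral_eq_Suc)
  qed
  let ?Z = "PSum i j {}"
  have "reach S ({}, L) 0 ({?Z}, L)"
    using reach_fire[of "Zero i j" "{}" "{}" S] S by simp
  also have "reach S ({?Z}, L) 1 ({?Z}, insert ?Z L)"
    by (rule reach_store) simp
  also have "reach S ({?Z}, insert ?Z L) 0 ({}, ?L 0)"
    using reach_discard[of S "{?Z}" _ ?Z] by simp
  also have "reach S ({}, ?L 0) (n * 4) ({}, ?L n)"
    by (rule reach_iterate[where st = "\<lambda>k. ({}, ?L k)"]) (rule step)
  finally show ?thesis
    by (simp add: algebra_simps)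
qed

section \<open>Assembling the tiles\<close>

text \<open>Every tile starts and ends with an empty fast level and tolerates extra slow words, so
  tiles run in any order. All products are computed because the inputs cover no triple while the
  outputs cover all of them.\<close>

lemma matmul_run_tiles:
  assumes T: "finite T" and out: "outputs n \<subseteq> (\<Union>t\<in>T. W t)"
    and tile: "\<And>t L. t \<in> T \<Longrightarrow> inputs n \<subseteq> L \<Longrightarrow> reach S ({}, L) q ({}, L \<union> W t)"
  shows "\<exists>sched final. matmul_run n S sched final \<and> outputs n \<subseteq> snd final \<and>
    word_crossings sched \<le> card T * q"
proof -
  let ?final = "({}, inputs n \<union> (\<Union>t\<in>T. W t))"
  have "reach S ({}, inputs n \<union> (\<Union>t\<in>{}. W t)) (card T * q) ?final"
  proof (rule reach_iterate_set[where st = "\<lambda>Y. ({}, inputs n \<union> (\<Union>t\<in>Y. W t))", OF T])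
    fix t Y
    assume "t \<in> T"
    then have "reach S ({}, inputs n \<union> (\<Union>t\<in>Y. W t)) q ({}, inputs n \<union> (\<Union>t\<in>Y. W t) \<union> W t)"
      by (rule tile) simp
    then show "reach S ({}, inputs n \<union> (\<Union>t\<in>Y. W t)) q ({}, inputs n \<union> (\<Union>t\<in>insert t Y. W t))"
      by (simp add: Un_ac)
  qed
  then obtain xs where run: "run S ({}, inputs n) xs ?final" and xs: "word_crossings xs \<le> card T * q"
    by (auto simp: reach_def)
  have "\<exists>f D. Fire f D \<in> set xs \<and> computes_product i k j f" if "i < n" "k < n" "j < n" for i k j
    using run_fresh[OF run, of i k j] covered_outputs[OF _ that, of "inputs n \<union> (\<Union>t\<in>T. W t)"] out
    by (simp add: covered_inputs le_supI2)
  then show ?thesis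
    using run xs out unfolding matmul_run_def
    by (intro exI[of _ xs] exI[of _ ?final]) auto
qed

lemma card_div_eq_le: "0 < b \<Longrightarrow> card {i. i < n \<and> i div b = p} \<le> (b :: nat)"
proof -
  assume b: "0 < b"
  have "{i. i < n \<and> i div b = p} \<subseteq> {p * b..<p * b + b}"
    using b dividend_less_div_times[OF b] by (auto simp: add.commute)
  then have "card {i. i < n \<and> i div b = p} \<le> card {p * b..<p * b + b}"
    by (rule card_mono[rotated]) simp
  then show ?thesis
    by simp
qed

lemma matmul_run_blocked:
  assumes b: "0 < b" and S: "b + 1 + b * b \<le> S"
  shows "\<exists>sched final. matmul_run n S sched final \<and> outputs n \<subseteq> snd final \<and>
    word_crossings sched \<le> (n div b + 1) ^ 2 * (2 * n * b + b * b)"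
proof -
  \<comment> \<open>Grouping by \<open>i div b\<close> needs no divisibility of \<open>n\<close> by
    \<open>b\<close>; the last group may be short or empty.\<close>
  define I where "I p = {i. i < n \<and> i div b = p}" for p
  have I: "finite (I p)" "card (I p) \<le> b" for p
    using card_div_eq_le[OF b] by (auto simp: I_def)
  let ?T = "{..<n div b + 1} \<times> {..<n div b + 1}"
  have "\<exists>sched final. matmul_run n S sched final \<and> outputs n \<subseteq> snd final \<and>
    word_crossings sched \<le> card ?T * (2 * n * b + b * b)"
  proof (rule matmul_run_tiles[where W = "\<lambda>(p, q). accumulators n (I p \<times> I q) {}"])
    have "PSum i j {..<n} \<in> (\<Union>(p, q)\<in>?T. accumulators n (I p \<times> I q) {})"
      if "i < n" "j < n" for i j
      using that by (intro UN_I[of "(i div b, j div b)"])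
        (auto simp: accumulators_simps I_def less_Suc_eq_le div_le_mono)
    then show "outputs n \<subseteq> (\<Union>(p, q)\<in>?T. accumulators n (I p \<times> I q) {})"
      unfolding outputs_def by blast
  next
    fix t :: "nat \<times> nat" and L
    assume "inputs n \<subseteq> L"
    obtain p q where t: "t = (p, q)"
      by (cases t)
    have "card (I p) + 1 + card (I p) * card (I q) \<le> b + 1 + b * b"
      by (intro add_mono mult_le_mono I order_refl)
    then have "reach S ({}, L) (n * (card (I p) + card (I q)) + card (I p) * card (I q))
        ({}, L \<union> accumulators n (I p \<times> I q) {})"
      using S \<open>inputs n \<subseteq> L\<close> by (intro reach_block I) (auto simp: inputs_def I_def)
    moreover have "n * (card (I p) + card (I q)) + card (I p) * card (I q) \<le> n * (b + b) + b * b"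
      by (intro add_mono mult_le_mono I order_refl)
    then have "n * (card (I p) + card (I q)) + card (I p) * card (I q) \<le> 2 * n * b + b * b"
      by (simp add: algebra_simps)
    ultimately show "reach S ({}, L) (2 * n * b + b * b)
        ({}, L \<union> (case t of (p, q) \<Rightarrow> accumulators n (I p \<times> I q) {}))"
      unfolding t prod.case by (rule reach_mono)
  qed simp
  then show ?thesis
    by (simp add: card_cartesian_product power2_eq_square)
qed

lemma matmul_run_two_words:
  assumes "2 \<le> S"
  shows "\<exists>sched final. matmul_run n S sched final \<and> outputs n \<subseteq> snd final \<and>
    word_crossings sched \<le> n * n * (4 * n + 1)"
proof -
  have "\<exists>sched final. matmul_run n S sched final \<and> outputs n \<subseteq> snd final \<and>
    word_crossings sched \<le> card ({..<n} \<times> {..<n}) * (4 * n + 1)"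
  proof (rule matmul_run_tiles[where W = "\<lambda>(i, j). (\<lambda>m. PSum i j {..<m}) ` {..n}"])
    fix t L
    assume "t \<in> {..<n} \<times> {..<n}" and L: "inputs n \<subseteq> L"
    then obtain i j where t: "t = (i, j)" "i < n" "j < n"
      by auto
    have "InA i k \<in> L \<and> InB k j \<in> L" if "k < n" for k
      using that t L by (auto simp: inputs_def)
    then show "reach S ({}, L) (4 * n + 1)
        ({}, L \<union> (case t of (i, j) \<Rightarrow> (\<lambda>m. PSum i j {..<m}) ` {..n}))"
      unfolding t prod.case using assms by (rule reach_entry_two_words)
  qed (auto simp: outputs_def)
  then show ?thesis
    by (simp add: card_cartesian_product)
qed

section \<open>Choice of the block size\<close>

text \<open>Take \<open>b = min r n\<close> with \<open>r\<close> the floor of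
  \<open>sqrt (S / 3)\<close>. For \<open>r \<ge> 1\<close> all three terms of the capacity
  condition are at most \<open>r * r\<close>. Where \<open>n\<close> is the minimum, the bound on
  \<open>S\<close> by \<open>K\<close> keeps \<open>b\<close> of order \<open>sqrt S\<close>; the
  constant adds up both cases.\<close>

lemma block_size_exists:
  fixes n S :: nat and K :: real
  assumes S: "3 \<le> S" "real S \<le> K * real n ^ 2"
  obtains b where "0 < b" "b \<le> n" "b + 1 + b * b \<le> S" "sqrt S \<le> (4 + sqrt K) * real b"
proof -
  define r where "r = nat \<lfloor>sqrt (real S / 3)\<rfloor>"
  have n: "0 < n"
    using S by (cases n) auto
  have K: "0 \<le> K"
    using S n by (smt (verit) mult_neg_pos of_nat_0_le_iff of_nat_0_less_iff zero_less_power)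
  have "1 \<le> sqrt (real S / 3)"
    using S by simp
  then have r: "1 \<le> r" "real r \<le> sqrt (real S / 3)" "sqrt (real S / 3) \<le> real r + 1"
    unfolding r_def by linarith+
  have "real r ^ 2 \<le> real S / 3"
    using r(2) by (metis of_nat_0_le_iff power_mono real_sqrt_pow2 divide_nonneg_nonneg zero_le_numeral)
  then have "real (3 * (r * r)) \<le> real S"
    by (simp add: power2_eq_square)
  then have rS: "3 * (r * r) \<le> S"
    by (simp only: of_nat_le_iff)
  have "sqrt (real S) = sqrt 3 * sqrt (real S / 3)"
    by (simp add: real_sqrt_mult[symmetric])
  \<comment> \<open>By \<open>sqrt 3 \<le> 2\<close> and \<open>r + 1 \<le> 2 * r\<close>.\<close>
  also have "\<dots> \<le> 2 * (2 * real r)"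
    using r by (intro mult_mono) (auto intro: real_le_lsqrt)
  finally have sr: "sqrt (real S) \<le> 4 * real r"
    by simp
  have sn: "sqrt (real S) \<le> sqrt K * real n"
    using real_sqrt_le_mono[OF S(2)] by (simp add: real_sqrt_mult)
  show ?thesis
  proof (rule that[of "min r n"])
    show "0 < min r n" "min r n \<le> n"
      using r n by auto
    have "1 \<le> r * r" "r \<le> r * r"
      using r by auto
    moreover have "min r n * min r n \<le> r * r"
      by (intro mult_le_mono) auto
    ultimately show "min r n + 1 + min r n * min r n \<le> S"
      using rS by linarith
    have "0 \<le> sqrt K * real r" "0 \<le> 4 * real n"
      using K by auto
    then show "sqrt (real S) \<le> (4 + sqrt K) * real (min r n)"
      using sr sn by (auto simp: min_def algebra_simps)
  qed
qed

text \<open>Both regimes provide a \<open>b\<close> of order \<open>sqrt S\<close> with at most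
  \<open>12 * n ^ 3 / b\<close> crossings. A block with \<open>b = 1\<close> needs three words, so
  \<open>S = 2\<close> uses the two-word schedule, with 1 in the role of \<open>b\<close>.\<close>

lemma matmul_crossings_upper:
  assumes S: "2 \<le> S" "real S \<le> K * real n ^ 2"
  shows "\<exists>sched final. matmul_run n S sched final \<and> outputs n \<subseteq> snd final \<and>
    real (word_crossings sched) \<le> 12 * (4 + sqrt K) * (real n ^ 3 / sqrt (real S))"
proof -
  have n: "0 < n"
    using S by (cases n) auto
  have K: "0 \<le> K"
    using S n by (smt (verit) mult_neg_pos of_nat_0_le_iff of_nat_0_less_iff zero_less_power)
  have "\<exists>b sched final. matmul_run n S sched final \<and> outputs n \<subseteq> snd final \<and>
    word_crossings sched * b \<le> 12 * n ^ 3 \<and> sqrt S \<le> (4 + sqrt K) * real b"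
  proof (cases "S = 2")
    case True
    obtain sched final where "matmul_run n S sched final" "outputs n \<subseteq> snd final"
      and q: "word_crossings sched \<le> n * n * (4 * n + 1)"
      using matmul_run_two_words[OF S(1)] by blast
    moreover have "n * n * (4 * n + 1) \<le> n * n * (12 * n)"
      using n by (intro mult_le_mono order_refl) simp
    with q have "word_crossings sched \<le> n * n * (12 * n)"
      by (rule order_trans)
    then have "word_crossings sched * 1 \<le> 12 * n ^ 3"
      by (simp add: power3_eq_cube)
    moreover have "sqrt 2 \<le> 2"
      by (rule real_le_lsqrt) auto
    then have "sqrt S \<le> (4 + sqrt K) * real 1"
      using True K by (simp add: add_increasing2)
    ultimately show ?thesis
      by blast
  next
    case False
    with S obtain b where b: "0 < b" "b \<le> n" "b + 1 + b * b \<le> S" "sqrt S \<le> (4 + sqrt K) * real b"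
      using block_size_exists[of S K n] by auto
    obtain sched final where "matmul_run n S sched final" "outputs n \<subseteq> snd final"
      and q: "word_crossings sched \<le> (n div b + 1) ^ 2 * (2 * n * b + b * b)"
      using matmul_run_blocked[OF b(1,3)] by blast
    moreover have mb: "(n div b + 1) * b \<le> 2 * n"
      unfolding distrib_right using b(2) div_times_less_eq_dividend[of n b] by linarith
    \<comment> \<open>Rounding up the number of tiles at most doubles \<open>n\<close>, as
      \<open>b \<le> n\<close>; hence 12 as \<open>2 ^ 2 * 3\<close>.\<close>
    have "((n div b + 1) * b) ^ 2 * (2 * n + b) \<le> (2 * n) ^ 2 * (3 * n)"
      by (intro mult_le_mono power_mono mb) (use b(2) in simp_all)
    then have "(n div b + 1) ^ 2 * (2 * n * b + b * b) * b \<le> 12 * n ^ 3"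
      by (simp add: power2_eq_square power3_eq_cube algebra_simps)
    then have "word_crossings sched * b \<le> 12 * n ^ 3"
      using mult_le_mono1[OF q, of b] by linarith
    ultimately show ?thesis
      using b(4) by blast
  qed
  then obtain b sched final where run: "matmul_run n S sched final" "outputs n \<subseteq> snd final"
    and q: "word_crossings sched * b \<le> 12 * n ^ 3" and b: "sqrt S \<le> (4 + sqrt K) * real b"
    by blast
  have "real (word_crossings sched * b) \<le> real (12 * n ^ 3)"
    using q by (simp only: of_nat_le_iff)
  then have q': "real (word_crossings sched) * real b \<le> 12 * real n ^ 3"
    by simp
  have "real (word_crossings sched) * sqrt S \<le> real (word_crossings sched) * ((4 + sqrt K) * real b)"
    using b by (rule mult_left_mono) simp
  also have "\<dots> = (4 + sqrt K) * (real (word_crossings sched) * real b)"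
    by (simp only: mult_ac)
  also have "\<dots> \<le> (4 + sqrt K) * (12 * real n ^ 3)"
    using K by (intro mult_left_mono q') simp
  finally have "real (word_crossings sched) \<le> (4 + sqrt K) * (12 * real n ^ 3) / sqrt (real S)"
    using S(1) by (subst pos_le_divide_eq) simp_all
  then have "real (word_crossings sched) \<le> 12 * (4 + sqrt K) * (real n ^ 3 / sqrt (real S))"
    by (simp only: times_divide_eq_right mult_ac)
  then show ?thesis
    using run by blast
qed

text \<open>For \<open>n > 0\<close> every run loads all \<open>2 * n ^ 2\<close> inputs, so the
  upper bound can hold only while \<open>S\<close> is of order at most \<open>n ^ 2\<close>, with a
  constant depending on \<open>K\<close>; and a product needs both factors resident, hence
  \<open>2 \<le> S\<close>.\<close>

theorem theorem2:
  shows "(\<exists>c::real. c > 0 \<and>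
            (\<forall>(n::nat) (S::nat) (sched::step list) (final::state).
               matmul_run n S sched final \<longrightarrow>
                 c * (real n ^ 3 / sqrt (real S)) \<le> real (word_crossings sched) \<and>
                 (\<forall>(w::nat) (c\<^sub>0::real) (E::real).
                    0 \<le> c\<^sub>0 \<and> fare c\<^sub>0 w sched \<le> E \<longrightarrow>
                      c\<^sub>0 * real w * (c * (real n ^ 3 / sqrt (real S))) \<le> E)))
       \<and> (\<forall>K::real. \<exists>C::real. C > 0 \<and>
            (\<forall>(n::nat) (S::nat). 2 \<le> S \<and> real S \<le> K * real n ^ 2 \<longrightarrow>
               (\<exists>(sched::step list) (final::state).
                  matmul_run n S sched final \<and> outputs n \<subseteq> snd final \<and>
                  real (word_crossings sched) \<le> C * (real n ^ 3 / sqrt (real S)))))"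
proof (intro conjI allI)
  show "\<exists>c::real. c > 0 \<and>
          (\<forall>(n::nat) (S::nat) (sched::step list) (final::state).
             matmul_run n S sched final \<longrightarrow>
               c * (real n ^ 3 / sqrt (real S)) \<le> real (word_crossings sched) \<and>
               (\<forall>(w::nat) (c\<^sub>0::real) (E::real).
                  0 \<le> c\<^sub>0 \<and> fare c\<^sub>0 w sched \<le> E \<longrightarrow>
                    c\<^sub>0 * real w * (c * (real n ^ 3 / sqrt (real S))) \<le> E))"
  proof (intro exI[of _ "1 / 8"] conjI allI impI)
    fix n S sched final
    assume "matmul_run n S sched final"
    then show le: "1 / 8 * (real n ^ 3 / sqrt (real S)) \<le> real (word_crossings sched)"
      using matmul_crossings_lower by fastforce
    fix w :: nat and c\<^sub>0 E :: real
    assume E: "0 \<le> c\<^sub>0 \<and> fare c\<^sub>0 w sched \<le> E"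
    then have "c\<^sub>0 * real w * (1 / 8 * (real n ^ 3 / sqrt (real S))) \<le>
        c\<^sub>0 * real w * real (word_crossings sched)"
      by (intro mult_left_mono le) simp
    also have "\<dots> = fare c\<^sub>0 w sched"
      by (simp add: fare_def bit_crossings_def)
    finally show "c\<^sub>0 * real w * (1 / 8 * (real n ^ 3 / sqrt (real S))) \<le> E"
      using E by linarith
  qed simp
next
  fix K :: real
  \<comment> \<open>For negative \<open>K\<close> the root \<open>sqrt K\<close> is negative too;
    the absolute value keeps the constant positive.\<close>
  have "real S \<le> \<bar>K\<bar> * real n ^ 2" if "real S \<le> K * real n ^ 2" for S n :: nat
    by (rule order_trans[OF that]) (intro mult_right_mono, simp_all)
  then show "\<exists>C::real. C > 0 \<and>
          (\<forall>(n::nat) (S::nat). 2 \<le> S \<and> real S \<le> K * real n ^ 2 \<longrightarrow>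
             (\<exists>(sched::step list) (final::state).
                matmul_run n S sched final \<and> outputs n \<subseteq> snd final \<and>
                real (word_crossings sched) \<le> C * (real n ^ 3 / sqrt (real S))))"
    by (intro exI[of _ "12 * (4 + sqrt \<bar>K\<bar>)"] conjI allI impI matmul_crossings_upper)
      (auto simp: add_pos_nonneg)
qed

end
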